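(* Let $G=\langle b,w\rangle$ be a finite group, $N\trianglelefteq G$, $\overline G=G/N$, $\overline b=bN$, $\overline w=wN$, $\mathcal{D}=\mathcal{D}(G,b,w)$ and $\mathcal{D}_N=\mathcal{D}(\overline G,\overline b,\overline w)$. Suppose $\chi(\mathcal{D}_N)<0$. Then $$\frac{\chi(\mathcal{D})}{\chi(\mathcal{D}_N)}\le 42|N|-41,$$ and equality holds if and only if $\mathcal{D}_N$ is a Hurwitz dessin and $\mathcal{D}$ is a totally branched covering of $\mathcal{D}_N$.
   Context: $\mathcal{D}(G,b,w)$ is the regular dessin with black vertices the right cosets of $\langle b\rangle$, white vertices the right cosets of $\langle w\rangle$, edges the elements of $G$, faces corresponding to right cosets of $\langle bw\rangle$; its Euler characteristic is $\chi=|V|-|E|+|F|=|G|(\frac1{|b|}+\frac1{|w|}+\frac1{|bw|}-1)$. A regular dessin $\mathcal{D}(H,x,y)$ is a Hurwitz dessin if $\{|x|,|y|,|xy|\}=\{2,3,7\}$. $\mathcal{D}$ is a totally branched covering of $\mathcal{D}_N$ if $\mathcal{D}$ and $\mathcal{D}_N$ have the same number of vertices and of faces, equivalently $N$ is contained in every vertex stabiliser and every face stabiliser (i.e. $N\le\langle b\rangle\cap\langle w\rangle\cap\langle bw\rangle$).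
   Formalization: The "only if" direction of the equality case is asserted only for nontrivial N: if N is trivial, the ratio is 1 = 42|N|-41 for every dessin with negative Euler characteristic, Hurwitz or not. The inequality and the "if" direction hold for all N. *)

theory Defs
  imports Complex_Main "HOL-Algebra.Algebra"
begin

text \<open>
  The cells of a dessin are represented by sets of edges: an edge is incident with
  exactly those vertices and faces that contain it.
\<close>

record 'a dessin =
  edges :: "'a set"
  black_vertices :: "'a set set"
  white_vertices :: "'a set set"
  faces :: "'a set set"

definition regular_dessin :: "('a, 'c) monoid_scheme \<Rightarrow> 'a \<Rightarrow> 'a \<Rightarrow> 'a dessin" where
  "regular_dessin G b w =
     \<lparr> edges = carrier G,
       black_vertices = rcosets\<^bsub>G\<^esub> (generate G {b}),
       white_vertices = rcosets\<^bsub>G\<^esub> (generate G {w}),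
       faces = rcosets\<^bsub>G\<^esub> (generate G {b \<otimes>\<^bsub>G\<^esub> w}) \<rparr>"

text \<open>
  The sum of sets is disjoint: the same coset may occur both as a black and as a white
  vertex (when the subgroups generated by \<open>b\<close> and \<open>w\<close> coincide), and counts twice then.
\<close>

definition vertices :: "'a dessin \<Rightarrow> ('a set + 'a set) set" where
  "vertices D = black_vertices D <+> white_vertices D"

definition euler_char :: "'a dessin \<Rightarrow> int" where
  "euler_char D = int (card (vertices D)) - int (card (edges D)) + int (card (faces D))"

definition quotient_dessin ::
    "('a, 'c) monoid_scheme \<Rightarrow> 'a set \<Rightarrow> 'a \<Rightarrow> 'a \<Rightarrow> 'a set dessin" where
  "quotient_dessin G N b w = regular_dessin (G Mod N) (N #>\<^bsub>G\<^esub> b) (N #>\<^bsub>G\<^esub> w)"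

text \<open>The three orders are required to be 2, 3, 7 in any arrangement.\<close>

definition hurwitz_dessin :: "('a, 'c) monoid_scheme \<Rightarrow> 'a \<Rightarrow> 'a \<Rightarrow> bool" where
  "hurwitz_dessin H x y \<longleftrightarrow>
     {group.ord H x, group.ord H y, group.ord H (x \<otimes>\<^bsub>H\<^esub> y)} = {2, 3, 7}"

definition totally_branched_covering ::
    "('a, 'c) monoid_scheme \<Rightarrow> 'a set \<Rightarrow> 'a \<Rightarrow> 'a \<Rightarrow> bool" where
  "totally_branched_covering G N b w \<longleftrightarrow>
     card (vertices (regular_dessin G b w)) = card (vertices (quotient_dessin G N b w)) \<and>
     card (faces (regular_dessin G b w)) = card (faces (quotient_dessin G N b w))"

end

theory Submission
  imports Defs
begin

text \<open>
  Write \<open>m = |N|\<close>, \<open>n = |G/N|\<close> and let \<open>s\<close> be the number of vertices and faces of the quotient.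
  Every coset count can only drop in the quotient, so \<open>-\<chi>(D) \<le> mn - s\<close> and the ratio is at most
  \<open>(mn - s)/(n - s) = 1 + (m - 1) n/(n - s)\<close>. Since \<open>s/n < 1\<close> is a sum of three unit fractions, it
  is at most \<open>1/2 + 1/3 + 1/7 = 41/42\<close>, that is \<open>n/(n - s) \<le> 42\<close>.
\<close>

text \<open>This is the arithmetic behind Hurwitz's bound. The triples (3,3,3), (2,4,4) and (2,3,6)
  sum to exactly 1; past each of them the best sums are 11/12, 19/20 and 41/42. The other ranges
  give at most 5/6 or 9/10, or a sum of at least 1.\<close>

lemma sum_unit_fractions_sorted:
  fixes k l p :: nat
  assumes "k \<le> l" "l \<le> p" "0 < k" and lt: "1 / real k + 1 / real l + 1 / real p < 1"
  shows "1 / real k + 1 / real l + 1 / real p \<le> 41 / 42 \<and>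
         (1 / real k + 1 / real l + 1 / real p = 41 / 42 \<longleftrightarrow> k = 2 \<and> l = 3 \<and> p = 7)"
proof -
  let ?f = "\<lambda>i::nat. 1 / real i"
  have mono: "?f j \<le> ?f i" if "0 < i" "i \<le> j" for i j
    using that by (simp add: frac_le)
  have pos: "0 < ?f l" "0 < ?f p"
    using assms by auto
  have k2: "k \<ge> 2"
    using lt pos \<open>0 < k\<close> by (cases "k = 1") auto
  consider "k \<ge> 4" | "k = 3" "l \<ge> 4" | "k = 3" "l = 3" | "k = 2" "l \<ge> 5" | "k = 2" "l = 4"
    | "k = 2" "l = 3" | "k = 2" "l = 2"
    using k2 \<open>k \<le> l\<close> by linarith
  then show ?thesis
  proof cases
    case 1
    then have "?f k \<le> 1 / 4" "?f l \<le> 1 / 4" "?f p \<le> 1 / 4"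
      using mono[of 4] assms by simp_all
    then have "?f k + ?f l + ?f p < 41 / 42" by linarith
    then show ?thesis using 1 by simp
  next
    case 2
    then have "?f k = 1 / 3" "?f l \<le> 1 / 4" "?f p \<le> 1 / 4"
      using mono[of 4] assms by simp_all
    then have "?f k + ?f l + ?f p < 41 / 42" by linarith
    then show ?thesis using 2 by simp
  next
    case 3
    then have "p \<noteq> 3" using lt by auto
    then have "p \<ge> 4" using 3 assms by linarith
    then have "?f k = 1 / 3" "?f l = 1 / 3" "?f p \<le> 1 / 4"
      using 3 mono[of 4] by simp_all
    then have "?f k + ?f l + ?f p < 41 / 42" by linarith
    then show ?thesis using 3 by simp
  next
    case 4
    then have "?f k = 1 / 2" "?f l \<le> 1 / 5" "?f p \<le> 1 / 5"
      using mono[of 5] assms by simp_all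
    then have "?f k + ?f l + ?f p < 41 / 42" by linarith
    then show ?thesis using 4 by simp
  next
    case 5
    then have "p \<noteq> 4" using lt by auto
    then have "p \<ge> 5" using 5 assms by linarith
    then have "?f k = 1 / 2" "?f l = 1 / 4" "?f p \<le> 1 / 5"
      using 5 mono[of 5] by simp_all
    then have "?f k + ?f l + ?f p < 41 / 42" by linarith
    then show ?thesis using 5 by simp
  next
    case 6
    \<comment> \<open>Up to \<open>p = 6\<close> the sum is at least 1/2 + 1/3 + 1/6 = 1, which
      \<open>lt\<close> excludes.\<close>
    have "p \<ge> 7"
    proof (rule ccontr)
      assume "\<not> p \<ge> 7"
      then have "?f k = 1 / 2" "?f l = 1 / 3" "1 / 6 \<le> ?f p"
        using mono[of p 6] 6 assms by simp_all
      then show False using lt by linarith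
    qed
    then have f: "?f k = 1 / 2" "?f l = 1 / 3" "?f p \<le> 1 / 7"
      using mono[of 7 p] 6 by simp_all
    have "?f p = 1 / 7 \<longleftrightarrow> p = 7" by (auto simp: field_simps)
    moreover have "?f k + ?f l + ?f p = 41 / 42 \<longleftrightarrow> ?f p = 1 / 7"
      "?f k + ?f l + ?f p \<le> 41 / 42"
      using f by linarith+
    ultimately show ?thesis using 6 by simp
  next
    case 7
    then show ?thesis using lt pos by simp
  qed
qed

text \<open>Links the unordered condition in \<open>hurwitz_dessin\<close> to the ordered extremal
  triple: the least entry must be 2, the greatest 7, and only \<open>l\<close> is left to be
  3.\<close>

lemma sorted_triple_eq_2_3_7:
  fixes k l p :: nat
  assumes "k \<le> l" "l \<le> p"
  shows "{k, l, p} = {2, 3, 7} \<longleftrightarrow> k = 2 \<and> l = 3 \<and> p = 7"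
proof
  assume eq: "{k, l, p} = {2, 3, 7}"
  then have mem: "2 \<in> {k, l, p}" "3 \<in> {k, l, p}" "7 \<in> {k, l, p}"
      "k \<in> {2, 3, 7}" "p \<in> {2, 3, 7}"
    by blast+
  have "k \<le> 2" "7 \<le> p"
    using mem(1,3) assms unfolding insert_iff empty_iff by presburger+
  then have "k = 2" "p = 7"
    using mem(4,5) by auto
  with mem(2) have "k = 2" "p = 7" "l = 3"
    by simp_all
  then show "k = 2 \<and> l = 3 \<and> p = 7"
    by simp
qed simp

text \<open>Sum and set are symmetric, so each of the six orderings reduces to the sorted
  case.\<close>

lemma sum_unit_fractions_less_one:
  fixes k l p :: nat
  assumes "0 < k" "0 < l" "0 < p" and "1 / real k + 1 / real l + 1 / real p < 1"
  shows "1 / real k + 1 / real l + 1 / real p \<le> 41 / 42 \<and>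
         (1 / real k + 1 / real l + 1 / real p = 41 / 42 \<longleftrightarrow> {k, l, p} = {2, 3, 7})"
proof -
  consider "k \<le> l" "l \<le> p" | "k \<le> p" "p \<le> l" | "l \<le> k" "k \<le> p" | "l \<le> p" "p \<le> k"
    | "p \<le> k" "k \<le> l" | "p \<le> l" "l \<le> k"
    by linarith
  then show ?thesis
  proof cases
    case 1
    then show ?thesis
      using sum_unit_fractions_sorted[of k l p] sorted_triple_eq_2_3_7[of k l p] assms
      by (simp add: insert_commute add_ac)
  next
    case 2
    then show ?thesis
      using sum_unit_fractions_sorted[of k p l] sorted_triple_eq_2_3_7[of k p l] assms
      by (simp add: insert_commute add_ac)
  next
    case 3
    then show ?thesis
      using sum_unit_fractions_sorted[of l k p] sorted_triple_eq_2_3_7[of l k p] assms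
      by (simp add: insert_commute add_ac)
  next
    case 4
    then show ?thesis
      using sum_unit_fractions_sorted[of l p k] sorted_triple_eq_2_3_7[of l p k] assms
      by (simp add: insert_commute add_ac)
  next
    case 5
    then show ?thesis
      using sum_unit_fractions_sorted[of p k l] sorted_triple_eq_2_3_7[of p k l] assms
      by (simp add: insert_commute add_ac)
  next
    case 6
    then show ?thesis
      using sum_unit_fractions_sorted[of p l k] sorted_triple_eq_2_3_7[of p l k] assms
      by (simp add: insert_commute add_ac)
  qed
qed

context group
begin

lemma card_rcosets_generate_mult_ord:
  assumes "finite (carrier G)" "x \<in> carrier G"
  shows "card (rcosets (generate G {x})) * ord x = order G"
proof -
  have "subgroup (generate G {x}) G"
    using assms by (simp add: generate_is_subgroup)
  from lagrange_finite[OF assms(1) this] show ?thesis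
    using generate_pow_card[OF assms(2)] by simp
qed

lemma finite_rcosets_generate:
  assumes "finite (carrier G)" "x \<in> carrier G"
  shows "finite (rcosets (generate G {x}))"
  using assms rcosets_subset_PowG[OF generate_is_subgroup, of "{x}"]
  by (meson empty_subsetI finite_Pow_iff finite_subset insert_subset)

lemma card_vertices_regular_dessin:
  assumes "finite (carrier G)" "b \<in> carrier G" "w \<in> carrier G"
  shows "card (vertices (regular_dessin G b w)) =
    card (rcosets (generate G {b})) + card (rcosets (generate G {w}))"
  using assms by (simp add: vertices_def regular_dessin_def card_Plus finite_rcosets_generate)

text \<open>The two counts are |G/N| / k and |G| / ord x, where k is the order of Nx, so the claim
  amounts to ord x \<le> k |N|. This holds because x^k lies in N and is therefore killed by the
  exponent |N|.\<close>

lemma card_rcosets_generate_Mod_le: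
  assumes fin: "finite (carrier G)" and x: "x \<in> carrier G" and "N \<lhd> G"
  shows "card (rcosets\<^bsub>G Mod N\<^esub> (generate (G Mod N) {N #> x}))
    \<le> card (rcosets (generate G {x}))"
proof -
  interpret N: normal N G by fact
  interpret Q: group "G Mod N" by (rule N.factorgroup_is_group)
  have Nx: "N #> x \<in> carrier (G Mod N)"
    using x by (auto simp: FactGroup_def RCOSETS_def)
  have finQ: "finite (carrier (G Mod N))"
    using fin by (simp add: FactGroup_def RCOSETS_def)
  define k where "k = Q.ord (N #> x)"
  have "k > 0"
    unfolding k_def using Q.ord_ge_1[OF finQ Nx] by simp
  have pow: "(N #> x) [^]\<^bsub>G Mod N\<^esub> i = N #> (x [^] i)" for i :: nat
    using x by (induction i) (auto simp: FactGroup_def N.rcos_sum coset_mult_one N.subset)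
  have "N #> (x [^] k) = N"
    using Q.pow_ord_eq_1[OF Nx] pow[of k] unfolding k_def by (simp add: FactGroup_def)
  then have xk: "x [^] k \<in> N"
    using rcos_self[OF nat_pow_closed[OF x] N.subgroup_axioms] by metis
  have "(x [^] k) [^] card N = \<one>"
  proof -
    \<comment> \<open>Lagrange is applied inside \<open>N\<close>, regarded as a group with the
      operation of \<open>G\<close>; powers agree in both.\<close>
    interpret H: group "G\<lparr>carrier := N\<rparr>"
      by (rule N.subgroup_is_group[OF is_group])
    show ?thesis
      using H.pow_order_eq_1[of "x [^] k"] xk by (simp add: order_def nat_pow_consistent[symmetric])
  qed
  then have "ord x dvd k * card N"
    using x by (simp add: pow_eq_id nat_pow_pow)
  moreover have "card N > 0"
    using finite_subset[OF N.subset fin] N.one_closed by (metis card_gt_0_iff empty_iff)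
  ultimately have le: "ord x \<le> k * card N"
    using \<open>k > 0\<close> by (simp add: dvd_imp_le)
  let ?r = "card (rcosets (generate G {x}))"
  let ?q = "card (rcosets\<^bsub>G Mod N\<^esub> (generate (G Mod N) {N #> x}))"
  \<comment> \<open>Both counts are compared through |G|, after multiplication by the positive
    number \<open>k * card N\<close>, which cancels at the end.\<close>
  have "?q * (k * card N) = order (G Mod N) * card N"
    using Q.card_rcosets_generate_mult_ord[OF finQ Nx] by (simp add: k_def mult.assoc[symmetric])
  also have "\<dots> = order G"
    using lagrange_finite[OF fin N.subgroup_axioms] by (simp add: order_def FactGroup_def)
  also have "\<dots> = ?r * ord x"
    using card_rcosets_generate_mult_ord[OF fin x] by simp
  also have "\<dots> \<le> ?r * (k * card N)"
    using le by simp
  finally show ?thesis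
    using \<open>k > 0\<close> \<open>card N > 0\<close> by simp
qed

end

text \<open>For trivial \<open>N\<close> the ratio is 1 = 42 - 41 whatever the orders of the
  generators, so equality implies the Hurwitz condition only when
  \<open>N \<noteq> {\<one>}\<close>.\<close>

theorem mainTheorem7:
  fixes G :: "('a, 'c) monoid_scheme" (structure) and N :: "'a set" and b w :: 'a
  assumes "group G" and "finite (carrier G)"
    and "b \<in> carrier G" and "w \<in> carrier G" and "carrier G = generate G {b, w}"
    and "N \<lhd> G"
    and "euler_char (quotient_dessin G N b w) < 0"
  shows "let ratio = real_of_int (euler_char (regular_dessin G b w)) /
                     real_of_int (euler_char (quotient_dessin G N b w));
             bound = 42 * real (card N) - 41;
             extremal = hurwitz_dessin (G Mod N) (N #> b) (N #> w) \<and>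
                        totally_branched_covering G N b w
         in ratio \<le> bound \<and>
            (extremal \<longrightarrow> ratio = bound) \<and>
            (N \<noteq> {\<one>} \<longrightarrow> (ratio = bound \<longleftrightarrow> extremal))"
proof -
  interpret group G by fact
  interpret N: normal N G by fact
  interpret Q: group "G Mod N" by (rule N.factorgroup_is_group)
  note fin = assms(2) and bw = assms(3,4)
  have finQ: "finite (carrier (G Mod N))"
    using fin by (simp add: FactGroup_def RCOSETS_def)
  have Q: "N #> x \<in> carrier (G Mod N)" if "x \<in> carrier G" for x
    using that by (auto simp: FactGroup_def RCOSETS_def)
  have mult: "(N #> b) \<otimes>\<^bsub>G Mod N\<^esub> (N #> w) = N #> (b \<otimes> w)"
    using bw by (simp add: FactGroup_def N.rcos_sum)
  \<comment> \<open>\<open>r\<close> counts cosets in \<open>G\<close> and \<open>q\<close> in the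
    quotient; likewise primed letters belong to the quotient dessin.\<close>
  define r where "r x = card (rcosets (generate G {x}))" for x
  define q where "q x = card (rcosets\<^bsub>G Mod N\<^esub> (generate (G Mod N) {N #> x}))" for x
  define n m where "n = order (G Mod N)" and "m = card N"
  define V F where "V = r b + r w" and "F = r (b \<otimes> w)"
  define V' F' where "V' = q b + q w" and "F' = q (b \<otimes> w)"
  have V: "card (vertices (regular_dessin G b w)) = V"
    unfolding V_def r_def using card_vertices_regular_dessin[OF fin bw] .
  have F: "card (faces (regular_dessin G b w)) = F"
    by (simp add: F_def r_def regular_dessin_def)
  have V': "card (vertices (quotient_dessin G N b w)) = V'"
    unfolding V'_def q_def quotient_dessin_def
    using Q.card_vertices_regular_dessin[OF finQ Q Q] bw by simp
  have F': "card (faces (quotient_dessin G N b w)) = F'"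
    by (simp add: F'_def q_def quotient_dessin_def regular_dessin_def N.rcos_sum bw)
  have order: "order G = n * m"
    using lagrange_finite[OF fin N.subgroup_axioms] by (simp add: n_def m_def order_def FactGroup_def)
  have chi: "euler_char (regular_dessin G b w) = int (V + F) - int (n * m)"
    unfolding euler_char_def V F by (simp add: order[symmetric] regular_dessin_def order_def)
  have chi': "euler_char (quotient_dessin G N b w) = int (V' + F') - int n"
    unfolding euler_char_def V' F' by (simp add: quotient_dessin_def regular_dessin_def n_def order_def)
  have neg: "V' + F' < n"
    using assms(7) unfolding chi' by simp
  have le: "V' \<le> V" "F' \<le> F"
    unfolding V_def V'_def F_def F'_def r_def q_def
    using card_rcosets_generate_Mod_le[OF fin _ \<open>N \<lhd> G\<close>] bw by (auto intro: add_mono)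
  have npos: "n > 0" using neg by simp
  have mpos: "m > 0"
    unfolding m_def using finite_subset[OF N.subset fin] N.one_closed by (metis card_gt_0_iff empty_iff)
  have pos: "0 < Q.ord (N #> x)" and frac: "real (q x) = n * (1 / Q.ord (N #> x))"
    if "x \<in> carrier G" for x
  proof -
    show pos: "0 < Q.ord (N #> x)"
      using Q.ord_ge_1[OF finQ Q[OF that]] by simp
    have "real (q x) * real (Q.ord (N #> x)) = real n"
      unfolding q_def n_def
      using Q.card_rcosets_generate_mult_ord[OF finQ Q[OF that]] by (metis of_nat_mult)
    then show "real (q x) = n * (1 / Q.ord (N #> x))"
      using pos by (simp add: field_simps)
  qed
  \<comment> \<open>The Euler characteristic of the quotient is n (u - 1), so its negativity is the
    hypothesis \<open>u < 1\<close> of the unit fraction estimate.\<close>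
  define u where
    "u = 1 / real (Q.ord (N #> b)) + 1 / real (Q.ord (N #> w)) + 1 / real (Q.ord (N #> (b \<otimes> w)))"
  have s: "real (V' + F') = n * u"
    unfolding V'_def F'_def u_def using bw by (simp add: frac distrib_left)
  have "real (V' + F') < real n" using neg by simp
  then have "u < 1"
    using npos unfolding s by simp
  have u: "u \<le> 41 / 42" "u = 41 / 42 \<longleftrightarrow> hurwitz_dessin (G Mod N) (N #> b) (N #> w)"
    unfolding u_def hurwitz_dessin_def mult
    using sum_unit_fractions_less_one \<open>u < 1\<close> pos bw unfolding u_def by simp_all
  define \<rho> where "\<rho> = real_of_int (euler_char (regular_dessin G b w)) /
                     real_of_int (euler_char (quotient_dessin G N b w))"
  define S S' :: real where "S = real V + real F" and "S' = real V' + real F'"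
  have S': "S' = n * u" using s by (simp add: S'_def)
  \<comment> \<open>Both signs are reversed to make the denominator positive.\<close>
  have "\<rho> = (n * m - S) / (n - S')"
    unfolding \<rho>_def chi chi' S_def S'_def using neg
    by (simp add: divide_simps) (simp add: algebra_simps)
  moreover have d: "0 < n - S'"
    using neg unfolding S'_def by linarith
  ultimately have "\<rho> * (n - S') = n * m - S"
    by simp
  \<comment> \<open>The gap to the bound is cleared of its denominator. Splitting off
    \<open>S - S'\<close> leaves (m - 1) (42 (n - S') - n), and \<open>S' = n * u\<close> turns this
    into a multiple of 41/42 - u.\<close>
  then have "(42 * real m - 41 - \<rho>) * (n - S') = (42 * real m - 41) * (n - S') - (n * m - S)"
    by (simp only: left_diff_distrib)
  \<comment> \<open>Both summands below are nonnegative, so equality in the bound forces each of them to vanish.\<close>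
  also have "\<dots> = (S - S') + 42 * (real m - 1) * n * (41 / 42 - u)"
    by (simp add: S' algebra_simps)
  finally have gap: "(42 * real m - 41 - \<rho>) * (n - S') =
      (S - S') + 42 * (real m - 1) * n * (41 / 42 - u)" .
  have g1: "0 \<le> S - S'" using le by (simp add: S_def S'_def)
  have g2: "0 \<le> 42 * (real m - 1) * n * (41 / 42 - u)"
    using mpos u(1) by simp
  have bound: "\<rho> \<le> 42 * real m - 41"
  proof -
    have "0 \<le> (42 * real m - 41 - \<rho>) * (n - S')"
      unfolding gap using g1 g2 by (rule add_nonneg_nonneg)
    then show ?thesis using d by (simp add: zero_le_mult_iff)
  qed
  have "\<rho> = 42 * real m - 41 \<longleftrightarrow> (42 * real m - 41 - \<rho>) * (n - S') = 0"
    using d by auto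
  also have "\<dots> \<longleftrightarrow> S - S' = 0 \<and> 42 * (real m - 1) * n * (41 / 42 - u) = 0"
    unfolding gap using g1 g2 by (rule add_nonneg_eq_0_iff)
  \<comment> \<open>Equality of the sums gives equal vertex counts and equal face counts separately,
    since neither count grows in the quotient.\<close>
  also have "S - S' = 0 \<longleftrightarrow> totally_branched_covering G N b w"
    unfolding totally_branched_covering_def V F V' F' S_def S'_def using le by auto
  also have "42 * (real m - 1) * n * (41 / 42 - u) = 0 \<longleftrightarrow> m = 1 \<or> u = 41 / 42"
    using npos by auto
  finally have eq: "\<rho> = 42 * real m - 41 \<longleftrightarrow>
      totally_branched_covering G N b w \<and> (m = 1 \<or> hurwitz_dessin (G Mod N) (N #> b) (N #> w))"
    using u(2) by simp
  \<comment> \<open>A one-element \<open>N\<close> consists of the identity, so nontriviality rules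
    out the alternative \<open>m = 1\<close> in \<open>eq\<close>.\<close>
  have "m \<noteq> 1" if "N \<noteq> {\<one>}"
    using that N.one_closed unfolding m_def by (metis card_1_singletonE singletonD)
  then show ?thesis
    using bound eq unfolding Let_def \<rho>_def m_def by blast
qed

end
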